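(* Let $K$ be a simplicial complex on the vertex set $[m]=\{v_1,\dots,v_m\}$ with $\operatorname{mdim} K=n-1$. Then the real moment-angle complex $\mathbb{R}\mathcal{Z}_K$ satisfies $$\operatorname{hrk}(\mathbb{R}\mathcal{Z}_K,\mathbb{Q})\ge 2^{m-n}.$$
   Context: A simplicial complex $K$ on the vertex set $[m]=\{v_1,\dots,v_m\}$ is a collection of subsets (simplices) of $[m]$, containing the empty set and closed under taking subsets; the dimension of a simplex $\omega$ is $|\omega|-1$. $\operatorname{mdim}K$ denotes the minimal dimension of the maximal-by-inclusion simplices of $K$. For a pair $(X,A)$ of CW-complexes and $\omega\subset[m]$ put $(X,A)^\omega=\{(x_1,\dots,x_m)\in X^m \mid x_i\in A \text{ whenever } v_i\notin\omega\}$. The $K$-power of $(X,A)$ is $(X,A)^K=\bigcup_{\omega\in K}(X,A)^\omega\subset X^m$. The real moment-angle complex is $\mathbb{R}\mathcal{Z}_K=(I^1,S^0)^K$, where $I^1=[-1,1]$ and $S^0=\{-1,1\}$ is its boundary. For a space $Y$, $\operatorname{hrk}(Y,\mathbb{Q})=\sum_i\dim_{\mathbb{Q}} H^i(Y,\mathbb{Q})$. *)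

theory Defs
  imports
    "HOL-Library.Extended_Real"
    "HOL-Homology.Homology"
    "HOL-Algebra.Module"
begin

section \<open>Dimension and quotients of vector spaces\<close>

definition finite_lin_indep :: "('k, 'c) ring_scheme \<Rightarrow> ('k, 'v, 'd) module_scheme \<Rightarrow> 'v set \<Rightarrow> bool"
  where "finite_lin_indep R M S \<longleftrightarrow>
    finite S \<and> S \<subseteq> carrier M \<and>
    (\<forall>a \<in> S \<rightarrow> carrier R.
       (\<Oplus>\<^bsub>M\<^esub>v\<in>S. a v \<odot>\<^bsub>M\<^esub> v) = \<zero>\<^bsub>M\<^esub> \<longrightarrow> (\<forall>v\<in>S. a v = \<zero>\<^bsub>R\<^esub>))"

text \<open>The dimension is \<open>\<infinity>\<close> (not \<open>0\<close>) for an infinite-dimensional space.\<close>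

definition vs_dim :: "('k, 'c) ring_scheme \<Rightarrow> ('k, 'v, 'd) module_scheme \<Rightarrow> enat"
  where "vs_dim R M = (SUP S \<in> {S. finite_lin_indep R M S}. enat (card S))"

text \<open>The record type \<open>module\<close> extends \<open>ring\<close>; its ring multiplication and unit play no
  role for modules and are left undefined.\<close>

definition quotient_module :: "('k, 'v, 'd) module_scheme \<Rightarrow> 'v set \<Rightarrow> ('k, 'v set) module"
  where "quotient_module M W =
    \<lparr>carrier = a_rcosets\<^bsub>M\<^esub> W, monoid.mult = undefined, one = undefined,
     zero = W, add = set_add M,
     module.smult = (\<lambda>q A. \<Union>x\<in>A. W +>\<^bsub>M\<^esub> (q \<odot>\<^bsub>M\<^esub> x))\<rparr>"

lemma (in module) quotient_smult_coset:
  assumes W: "submodule W R M" and q: "q \<in> carrier R" and x: "x \<in> carrier M"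
  shows "(\<Union>y \<in> W +>\<^bsub>M\<^esub> x. W +>\<^bsub>M\<^esub> (q \<odot>\<^bsub>M\<^esub> y)) = W +>\<^bsub>M\<^esub> (q \<odot>\<^bsub>M\<^esub> x)"
proof -
  have sub: "subgroup W (add_monoid M)"
    using W by (simp add: submodule_def)
  interpret W: abelian_subgroup W M
    by (rule abelian_subgroupI3) (auto intro: additive_subgroupI sub abelian_group_axioms)
  have "W +>\<^bsub>M\<^esub> (q \<odot>\<^bsub>M\<^esub> y) = W +>\<^bsub>M\<^esub> (q \<odot>\<^bsub>M\<^esub> x)" if "y \<in> W +>\<^bsub>M\<^esub> x" for y
  proof -
    obtain w where w: "w \<in> W" "y = w \<oplus>\<^bsub>M\<^esub> x"
      using \<open>y \<in> _\<close> by (auto simp: a_r_coset_def')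
    have wM: "w \<in> carrier M"
      using w(1) by simp
    have "q \<odot>\<^bsub>M\<^esub> w \<in> W"
      using submodule.smult_closed[OF W q w(1)] .
    moreover have "q \<odot>\<^bsub>M\<^esub> y = q \<odot>\<^bsub>M\<^esub> w \<oplus>\<^bsub>M\<^esub> q \<odot>\<^bsub>M\<^esub> x"
      using smult_r_distr[OF q wM x] w(2) by simp
    ultimately have "q \<odot>\<^bsub>M\<^esub> y \<in> W +>\<^bsub>M\<^esub> (q \<odot>\<^bsub>M\<^esub> x)"
      by (auto simp: a_r_coset_def')
    then show ?thesis
      using W.a_repr_independence' smult_closed[OF q x] by metis
  qed
  moreover have "x \<in> W +>\<^bsub>M\<^esub> x"
    using W.a_rcos_self[OF x] .
  ultimately show ?thesis by blast
qed

lemma (in module) module_quotient_module: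
  assumes W: "submodule W R M"
  shows "module R (quotient_module M W)"
proof -
  have sub: "subgroup W (add_monoid M)"
    using W by (simp add: submodule_def)
  interpret W: abelian_subgroup W M
    by (rule abelian_subgroupI3) (auto intro: additive_subgroupI sub abelian_group_axioms)
  let ?Q = "quotient_module M W"
  have coset: "\<exists>x \<in> carrier M. A = W +>\<^bsub>M\<^esub> x" if "A \<in> carrier ?Q" for A
    using that by (auto simp: quotient_module_def A_RCOSETS_def' a_r_coset_def')
  have smult: "q \<odot>\<^bsub>?Q\<^esub> (W +>\<^bsub>M\<^esub> x) = W +>\<^bsub>M\<^esub> (q \<odot>\<^bsub>M\<^esub> x)"
    if "q \<in> carrier R" "x \<in> carrier M" for q x
    using quotient_smult_coset[OF W that] by (simp add: quotient_module_def)
  have add: "(W +>\<^bsub>M\<^esub> x) \<oplus>\<^bsub>?Q\<^esub> (W +>\<^bsub>M\<^esub> y) = W +>\<^bsub>M\<^esub> (x \<oplus>\<^bsub>M\<^esub> y)"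
    if "x \<in> carrier M" "y \<in> carrier M" for x y
    using W.a_rcos_sum[OF that] by (simp add: quotient_module_def)
  have mem: "W +>\<^bsub>M\<^esub> x \<in> carrier ?Q" if "x \<in> carrier M" for x
    using that a_rcosetsI[OF W.a_subset] by (simp add: quotient_module_def)
  have zero: "\<zero>\<^bsub>?Q\<^esub> = W +>\<^bsub>M\<^esub> \<zero>\<^bsub>M\<^esub>"
    using a_coset_add_zero[OF W.a_subset] by (simp add: quotient_module_def)
  have ab: "abelian_group ?Q"
  proof (rule abelian_groupI)
    fix A assume "A \<in> carrier ?Q"
    then obtain x where x: "x \<in> carrier M" "A = W +>\<^bsub>M\<^esub> x"
      using coset by blast
    then show "\<exists>B \<in> carrier ?Q. B \<oplus>\<^bsub>?Q\<^esub> A = \<zero>\<^bsub>?Q\<^esub>"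
      by (intro bexI[of _ "W +>\<^bsub>M\<^esub> (\<ominus>\<^bsub>M\<^esub> x)"]) (simp_all add: add mem zero M.l_neg)
  qed (auto dest!: coset simp: add mem zero M.a_ac)
  show ?thesis
  proof (rule moduleI[OF R.is_cring ab])
  qed (auto dest!: coset simp: smult add mem smult_l_distr smult_r_distr smult_assoc1)
qed


section \<open>Singular cohomology with rational coefficients\<close>

definition rat_field :: "rat ring"
  where "rat_field = \<lparr>carrier = UNIV, monoid.mult = (*), one = 1, zero = 0, add = (+)\<rparr>"

lemma field_rat_field: "field rat_field"
proof (intro cring.cring_fieldI2 cringI abelian_groupI comm_monoidI)
  fix a :: rat assume "a \<in> carrier rat_field" "a \<noteq> \<zero>\<^bsub>rat_field\<^esub>"
  then show "\<exists>b \<in> carrier rat_field. a \<otimes>\<^bsub>rat_field\<^esub> b = \<one>\<^bsub>rat_field\<^esub>"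
    by (intro bexI[of _ "inverse a"]) (auto simp: rat_field_def)
next
  fix a :: rat assume "a \<in> carrier rat_field"
  then show "\<exists>b \<in> carrier rat_field. b \<oplus>\<^bsub>rat_field\<^esub> a = \<zero>\<^bsub>rat_field\<^esub>"
    by (intro bexI[of _ "- a"]) (auto simp: rat_field_def)
qed (auto simp: rat_field_def algebra_simps)

type_synonym 'a cochain = "((nat \<Rightarrow> real) \<Rightarrow> 'a) \<Rightarrow> rat"

text \<open>A homomorphism from the free abelian group of singular \<open>p\<close>-chains to \<open>\<rat>\<close> is represented
  by its values on the singular \<open>p\<close>-simplices; off these it is set to \<open>0\<close>, so that the
  representation is unique.\<close>

definition singular_cochain_set :: "nat \<Rightarrow> 'a topology \<Rightarrow> 'a cochain set"
  where "singular_cochain_set p X = {f. \<forall>s. \<not> singular_simplex p X s \<longrightarrow> f s = 0}"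

definition cochain_eval :: "'a cochain \<Rightarrow> 'a chain \<Rightarrow> rat"
  where "cochain_eval f c =
    (\<Sum>s \<in> Poly_Mapping.keys c. of_int (Poly_Mapping.lookup c s) * f s)"

definition cochain_module :: "nat \<Rightarrow> 'a topology \<Rightarrow> (rat, 'a cochain) module"
  where "cochain_module p X =
    \<lparr>carrier = singular_cochain_set p X, monoid.mult = undefined, one = undefined,
     zero = (\<lambda>_. 0), add = (\<lambda>f g s. f s + g s),
     module.smult = (\<lambda>q f s. q * f s)\<rparr>"

definition coboundary :: "nat \<Rightarrow> 'a topology \<Rightarrow> 'a cochain \<Rightarrow> 'a cochain"
  where "coboundary p X f = (\<lambda>s.
    if singular_simplex (Suc p) X s
    then cochain_eval f (chain_boundary (Suc p) (frag_of s)) else 0)"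

definition singular_cocycle_set :: "nat \<Rightarrow> 'a topology \<Rightarrow> 'a cochain set"
  where "singular_cocycle_set p X = {f \<in> singular_cochain_set p X. coboundary p X f = (\<lambda>_. 0)}"

definition singular_coboundary_set :: "nat \<Rightarrow> 'a topology \<Rightarrow> 'a cochain set"
  where "singular_coboundary_set p X =
    (case p of 0 \<Rightarrow> {\<lambda>_. 0} | Suc r \<Rightarrow> coboundary r X ` singular_cochain_set r X)"

definition cohomology :: "nat \<Rightarrow> 'a topology \<Rightarrow> (rat, 'a cochain set) module"
  where "cohomology p X =
    quotient_module ((cochain_module p X)\<lparr>carrier := singular_cocycle_set p X\<rparr>)
      (singular_coboundary_set p X)"

definition hrk :: "'a topology \<Rightarrow> enat"
  where "hrk X = suminf (\<lambda>i. vs_dim rat_field (cohomology i X))"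

lemma cochain_eval_superset:
  assumes "finite A" "Poly_Mapping.keys c \<subseteq> A"
  shows "cochain_eval f c = (\<Sum>s\<in>A. of_int (Poly_Mapping.lookup c s) * f s)"
  unfolding cochain_eval_def
  by (rule sum.mono_neutral_left) (use assms in \<open>auto simp: in_keys_iff\<close>)

lemma cochain_eval_zero [simp]: "cochain_eval f 0 = 0"
  and cochain_eval_of [simp]: "cochain_eval f (frag_of s) = f s"
  by (simp_all add: cochain_eval_def)

lemma cochain_eval_add: "cochain_eval f (c + d) = cochain_eval f c + cochain_eval f d"
proof -
  let ?A = "Poly_Mapping.keys c \<union> Poly_Mapping.keys d"
  have "Poly_Mapping.keys (c + d) \<subseteq> ?A"
    by (rule Poly_Mapping.keys_add)
  then show ?thesis
    by (simp add: cochain_eval_superset[of ?A] lookup_add algebra_simps sum.distrib)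
qed

lemma cochain_eval_minus: "cochain_eval f (- c) = - cochain_eval f c"
  by (simp add: cochain_eval_def sum_negf)

lemma cochain_eval_diff: "cochain_eval f (c - d) = cochain_eval f c - cochain_eval f d"
  using cochain_eval_add[of f c "- d"] by (simp add: cochain_eval_minus)

lemma cochain_eval_plus_left: "cochain_eval (\<lambda>s. f s + g s) c = cochain_eval f c + cochain_eval g c"
  by (simp add: cochain_eval_def algebra_simps sum.distrib)

lemma cochain_eval_cmul_left: "cochain_eval (\<lambda>s. q * f s) c = q * cochain_eval f c"
  by (simp add: cochain_eval_def sum_distrib_left mult_ac)

lemma cochain_eval_zero_left: "cochain_eval (\<lambda>_. 0) c = 0"
  by (simp add: cochain_eval_def)

lemma cochain_eval_coboundary:
  assumes "singular_chain (Suc p) X c"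
  shows "cochain_eval (coboundary p X f) c = cochain_eval f (chain_boundary (Suc p) c)"
  using assms[unfolded singular_chain_def]
proof (induction c rule: frag_induction)
  case zero
  then show ?case by simp
next
  case (one x)
  then show ?case by (simp add: coboundary_def)
next
  case (diff a b)
  then show ?case by (simp add: cochain_eval_diff chain_boundary_diff)
qed

lemma coboundary_coboundary: "coboundary (Suc p) X (coboundary p X f) = (\<lambda>_. 0)"
proof
  fix s
  show "coboundary (Suc p) X (coboundary p X f) s = 0"
  proof (cases "singular_simplex (Suc (Suc p)) X s")
    case True
    then have c: "singular_chain (Suc (Suc p)) X (frag_of s)"
      by (simp add: singular_chain_of)
    then have "singular_chain (Suc p) X (chain_boundary (Suc (Suc p)) (frag_of s))"
      using singular_chain_boundary_alt by blast
    then show ?thesis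
      using True c chain_boundary_boundary_alt[OF c]
      by (simp add: coboundary_def[of "Suc p"] cochain_eval_coboundary)
  qed (simp add: coboundary_def)
qed

lemma module_cochain_module: "module rat_field (cochain_module p X)"
proof (rule moduleI)
  show "cring rat_field"
    using field_rat_field by (simp add: field_def domain_def)
  show "abelian_group (cochain_module p X)"
  proof (rule abelian_groupI)
    fix f assume "f \<in> carrier (cochain_module p X)"
    then show "\<exists>g \<in> carrier (cochain_module p X). g \<oplus>\<^bsub>cochain_module p X\<^esub> f = \<zero>\<^bsub>cochain_module p X\<^esub>"
      by (intro bexI[of _ "\<lambda>s. - f s"]) (auto simp: cochain_module_def singular_cochain_set_def)
  qed (auto simp: cochain_module_def singular_cochain_set_def add_ac)
qed (auto simp: cochain_module_def singular_cochain_set_def rat_field_def algebra_simps)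

lemma a_inv_cochain_module:
  assumes "f \<in> singular_cochain_set p X"
  shows "\<ominus>\<^bsub>cochain_module p X\<^esub> f = (\<lambda>s. - f s)"
proof -
  interpret module rat_field "cochain_module p X" by (rule module_cochain_module)
  show ?thesis
    by (rule minus_equality)
      (use assms in \<open>auto simp: cochain_module_def singular_cochain_set_def\<close>)
qed

lemma coboundary_add: "coboundary p X (\<lambda>s. f s + g s) = (\<lambda>s. coboundary p X f s + coboundary p X g s)"
  and coboundary_cmul: "coboundary p X (\<lambda>s. q * f s) = (\<lambda>s. q * coboundary p X f s)"
  and coboundary_zero: "coboundary p X (\<lambda>_. 0) = (\<lambda>_. 0)"
  by (auto simp: coboundary_def cochain_eval_plus_left cochain_eval_cmul_left cochain_eval_zero_left)

lemma coboundary_uminus: "coboundary p X (\<lambda>s. - f s) = (\<lambda>s. - coboundary p X f s)"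
  using coboundary_cmul[of p X "-1" f] by simp

lemma submodule_cocycle: "submodule (singular_cocycle_set p X) rat_field (cochain_module p X)"
proof -
  interpret module rat_field "cochain_module p X" by (rule module_cochain_module)
  show ?thesis
  proof (rule submoduleI)
    fix f assume "f \<in> singular_cocycle_set p X"
    then show "\<ominus>\<^bsub>cochain_module p X\<^esub> f \<in> singular_cocycle_set p X"
      by (auto simp: singular_cocycle_set_def a_inv_cochain_module coboundary_uminus)
        (auto simp: singular_cochain_set_def)
  qed (auto simp: cochain_module_def singular_cocycle_set_def singular_cochain_set_def
      coboundary_add coboundary_cmul coboundary_zero)
qed

lemma coboundary_subset_cocycle: "singular_coboundary_set p X \<subseteq> singular_cocycle_set p X"
proof (cases p)
  case 0
  then show ?thesis
    by (auto simp: singular_coboundary_set_def singular_cocycle_set_def singular_cochain_set_def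
        coboundary_zero)
next
  case (Suc r)
  then show ?thesis
    by (auto simp: singular_coboundary_set_def singular_cocycle_set_def coboundary_coboundary)
      (auto simp: singular_cochain_set_def coboundary_def)
qed

lemma submodule_coboundary:
  "submodule (singular_coboundary_set p X) rat_field
     ((cochain_module p X)\<lparr>carrier := singular_cocycle_set p X\<rparr>)"
    (is "submodule ?B _ ?Z")
proof -
  interpret C: module rat_field "cochain_module p X" by (rule module_cochain_module)
  have "submodule ?B rat_field (cochain_module p X)"
  proof (rule C.submoduleI)
    show "?B \<subseteq> carrier (cochain_module p X)"
      using coboundary_subset_cocycle[of p X]
      by (auto simp: cochain_module_def singular_cocycle_set_def)
    show "\<zero>\<^bsub>cochain_module p X\<^esub> \<in> ?B"
      by (cases p) (auto simp: singular_coboundary_set_def cochain_module_def singular_cochain_set_def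
          coboundary_zero intro!: image_eqI[where x = "\<lambda>_. 0"])
  next
    fix f assume f: "f \<in> ?B"
    then have "f \<in> singular_cochain_set p X"
      using coboundary_subset_cocycle[of p X] by (auto simp: singular_cocycle_set_def)
    moreover have "(\<lambda>s. - f s) \<in> ?B"
    proof (cases p)
      case (Suc r)
      then obtain g where "g \<in> singular_cochain_set r X" "f = coboundary r X g"
        using f by (auto simp: singular_coboundary_set_def)
      then show ?thesis
        using Suc by (auto simp: singular_coboundary_set_def singular_cochain_set_def
            coboundary_uminus intro!: image_eqI[where x = "\<lambda>s. - g s"])
    qed (use f in \<open>auto simp: singular_coboundary_set_def\<close>)
    ultimately show "\<ominus>\<^bsub>cochain_module p X\<^esub> f \<in> ?B"
      by (simp add: a_inv_cochain_module)
  next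
    fix f g assume *: "f \<in> ?B" "g \<in> ?B"
    show "f \<oplus>\<^bsub>cochain_module p X\<^esub> g \<in> ?B"
    proof (cases p)
      case (Suc r)
      then obtain \<alpha> \<beta> where "\<alpha> \<in> singular_cochain_set r X" "f = coboundary r X \<alpha>"
        "\<beta> \<in> singular_cochain_set r X" "g = coboundary r X \<beta>"
        using * by (auto simp: singular_coboundary_set_def)
      then show ?thesis
        using Suc by (auto simp: singular_coboundary_set_def singular_cochain_set_def cochain_module_def
            coboundary_add intro!: image_eqI[where x = "\<lambda>s. \<alpha> s + \<beta> s"])
    qed (use * in \<open>auto simp: singular_coboundary_set_def cochain_module_def\<close>)
  next
    fix q f assume *: "q \<in> carrier rat_field" "f \<in> ?B"
    show "q \<odot>\<^bsub>cochain_module p X\<^esub> f \<in> ?B"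
    proof (cases p)
      case (Suc r)
      then obtain \<alpha> where "\<alpha> \<in> singular_cochain_set r X" "f = coboundary r X \<alpha>"
        using * by (auto simp: singular_coboundary_set_def)
      then show ?thesis
        using Suc by (auto simp: singular_coboundary_set_def singular_cochain_set_def cochain_module_def
            coboundary_cmul intro!: image_eqI[where x = "\<lambda>s. q * \<alpha> s"])
    qed (use * in \<open>auto simp: singular_coboundary_set_def cochain_module_def\<close>)
  qed
  then have "module rat_field ((cochain_module p X)\<lparr>carrier := ?B\<rparr>)"
    by (rule submodule.submodule_is_module) (rule module_cochain_module)
  moreover have Z: "module rat_field ?Z"
    by (rule submodule.submodule_is_module[OF submodule_cocycle]) (rule module_cochain_module)
  ultimately show ?thesis
    using module.module_incl_imp_submodule[OF Z, of ?B] coboundary_subset_cocycle[of p X]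
    by simp
qed

lemma module_cohomology: "module rat_field (cohomology p X)"
proof -
  interpret Z: module rat_field "(cochain_module p X)\<lparr>carrier := singular_cocycle_set p X\<rparr>"
    by (rule submodule.submodule_is_module[OF submodule_cocycle]) (rule module_cochain_module)
  show ?thesis
    unfolding cohomology_def by (rule Z.module_quotient_module[OF submodule_coboundary])
qed


section \<open>Simplicial complexes and real moment-angle complexes\<close>

text \<open>An element of the vertex set \<open>V\<close> need not span a simplex of \<open>K\<close> (ghost vertices are
  allowed).\<close>

definition abstract_simplicial_complex :: "'v set \<Rightarrow> 'v set set \<Rightarrow> bool"
  where "abstract_simplicial_complex V K \<longleftrightarrow>
    K \<subseteq> Pow V \<and> {} \<in> K \<and> (\<forall>\<omega>\<in>K. \<forall>\<tau>. \<tau> \<subseteq> \<omega> \<longrightarrow> \<tau> \<in> K)"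

definition simplex_dim :: "'v set \<Rightarrow> int"
  where "simplex_dim \<omega> = int (card \<omega>) - 1"

definition maximal_simplices :: "'v set set \<Rightarrow> 'v set set"
  where "maximal_simplices K = {\<omega> \<in> K. \<forall>\<tau>\<in>K. \<omega> \<subseteq> \<tau> \<longrightarrow> \<tau> = \<omega>}"

definition mdim :: "'v set set \<Rightarrow> int"
  where "mdim K = Min (simplex_dim ` maximal_simplices K)"

definition simplex_power :: "'v set \<Rightarrow> 'a topology \<Rightarrow> 'a set \<Rightarrow> 'v set \<Rightarrow> ('v \<Rightarrow> 'a) set"
  where "simplex_power V X A \<omega> =
    {x \<in> topspace (product_topology (\<lambda>_. X) V). \<forall>v \<in> V - \<omega>. x v \<in> A}"

definition complex_power :: "'v set \<Rightarrow> 'v set set \<Rightarrow> 'a topology \<Rightarrow> 'a set \<Rightarrow> ('v \<Rightarrow> 'a) topology"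
  where "complex_power V K X A =
    subtopology (product_topology (\<lambda>_. X) V) (\<Union>\<omega>\<in>K. simplex_power V X A \<omega>)"

definition real_moment_angle :: "'v set \<Rightarrow> 'v set set \<Rightarrow> ('v \<Rightarrow> real) topology"
  where "real_moment_angle V K = complex_power V K (top_of_set {-1..1}) {-1, 1}"

end

theory Submission
  imports Defs "HOL-Library.Function_Algebras"
begin

text \<open>
  Let \<open>\<omega>\<close> be a maximal simplex with \<open>n\<close> vertices. Setting the coordinates in \<open>\<omega>\<close> to \<open>0\<close> cuts the real
  moment-angle complex down to the \<open>2 ^ (m - n)\<close> points whose other coordinates are \<open>\<plusminus>1\<close>
  (\<open>zero_slice_maximal\<close>). Those points carry that many independent classes in degree \<open>0\<close>, and the idea is
  to give the coordinates back one at a time without losing rank.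

  Fix a vertex \<open>v \<in> \<omega>\<close> and restore the coordinate \<open>x v\<close>. The bigger space is symmetric under
  \<open>x v \<mapsto> - x v\<close>, so it is the double of its half \<open>x v \<ge> 0\<close> along the wall \<open>x v = 0\<close>, which is the space of
  the previous stage. A homology class of the wall that survives in the half survives in the double,
  since the double folds onto the half; a class that dies in the half dies in both halves, and the two
  bounding chains fit together to a new class one degree higher. Thus the total rank of the double is
  at least that of the wall (\<open>independent_cycles_double\<close>); degrees are shifted, but the number of
  independent classes is preserved. This is Mayer-Vietoris for a double, carried out on
  chains with the help of excision.

  The argument is run with integral cycles that are independent modulo boundaries. At the end they are
  converted into cohomology: as \<open>\<rat>\<close> is divisible, each member of an independent family of cycles has a
  Kronecker-dual rational cocycle (\<open>dual_cocycle_exists\<close>), and dual cocycles are independent in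
  cohomology (\<open>vs_dim_cohomology_ge\<close>).
\<close>

section \<open>Independent families of cycles and doubles\<close>

text \<open>Injectivity in the excision axiom, read on chains: a relative cycle that avoids the excised
  set \<open>U\<close> cannot become a relative boundary merely because \<open>U\<close> is available.\<close>

lemma excision_reflects_relboundary:
  assumes "X closure_of U \<subseteq> X interior_of T" and "T \<subseteq> S"
    and c: "singular_relcycle p (subtopology X (S - U)) (T - U) c"
    and bd: "singular_relboundary p (subtopology X S) T c"
  shows "singular_relboundary p (subtopology X (S - U)) (T - U) c"
proof -
  let ?X' = "subtopology X (S - U)" and ?T' = "T - U"
  let ?h = "hom_induced (int p) ?X' ?T' (subtopology X S) T id"
  have inj: "inj_on ?h (carrier (relative_homology_group (int p) ?X' ?T'))"
    using homology_excision_axiom[OF assms(1,2), of "int p"] by (auto simp: iso_def bij_betw_def)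
  have cm: "continuous_map ?X' (subtopology X S) id"
    by (auto simp: continuous_map_in_subtopology continuous_map_from_subtopology)
  have h: "?h (homologous_rel_set p ?X' ?T' d) = homologous_rel_set p (subtopology X S) T d"
    if "singular_relcycle p ?X' ?T' d" for d
  proof -
    have "chain_map p id d = d"
      using that by (meson chain_map_ident singular_relcycle)
    then show ?thesis
      using hom_induced_chain_map[OF cm _ that, of T] by simp
  qed
  have "homologous_rel_set p ?X' ?T' c = homologous_rel_set p ?X' ?T' 0"
  proof (rule inj_onD[OF inj])
    show "?h (homologous_rel_set p ?X' ?T' c) = ?h (homologous_rel_set p ?X' ?T' 0)"
    proof -
      have "homologous_rel p (subtopology X S) T c 0"
        using bd by (simp add: homologous_rel_def)
      then show ?thesis
        by (simp only: h[OF c] h[OF singular_relcycle_0] homologous_rel_set_eq)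
    qed
  qed (use c in \<open>auto simp: carrier_relative_homology_group\<close>)
  then have "homologous_rel p ?X' ?T' c 0"
    by (simp only: homologous_rel_set_eq)
  then show ?thesis
    by (simp add: homologous_rel_def)
qed

text \<open>The total rank of homology is bounded below by exhibiting a finite family of integral cycles,
  the \<open>i\<close>-th of degree \<open>dg i\<close>, whose classes are linearly independent over \<open>\<int>\<close> in each degree. Allowing
  the degrees to differ within one family is what makes the doubling argument clean: there the
  degrees of some members move up by one while the index set stays the same.\<close>

definition independent_cycles :: "'a topology \<Rightarrow> 'i set \<Rightarrow> ('i \<Rightarrow> nat) \<Rightarrow> ('i \<Rightarrow> 'a chain) \<Rightarrow> bool"
  where "independent_cycles X I dg c \<longleftrightarrow>
    finite I \<and> (\<forall>i\<in>I. singular_relcycle (dg i) X {} (c i)) \<and>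
    (\<forall>p n. singular_relboundary p X {} (\<Sum>i | i \<in> I \<and> dg i = p. frag_cmul (n i) (c i)) \<longrightarrow>
       (\<forall>i\<in>I. dg i = p \<longrightarrow> n i = 0))"

lemma independent_cyclesD:
  assumes "independent_cycles X I dg c"
    "singular_relboundary p X {} (\<Sum>i | i \<in> I \<and> dg i = p. frag_cmul (n i) (c i))"
    "i \<in> I" "dg i = p"
  shows "n i = 0"
  using assms by (auto simp: independent_cycles_def)

lemma frag_cmul_diff_distrib2: "frag_cmul n (a - b) = frag_cmul n a - frag_cmul n b"
  by (rule poly_mapping_eqI) (simp add: lookup_minus algebra_simps)

lemma frag_cmul_sum_left: "frag_cmul (sum n A) x = (\<Sum>a\<in>A. frag_cmul (n a) x)"
  by (induction A rule: infinite_finite_induct) (auto simp: frag_cmul_distrib)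

text \<open>Rank-nullity without a change of basis: pick a largest subfamily \<open>J\<close> that is still
  independent. Each remaining member satisfies, with a nonzero coefficient \<open>n k\<close> of its own, a relation
  that involves only itself and \<open>J\<close>. These relations are triangular in the members outside \<open>J\<close>, so
  they behave like a basis of the kernel up to finite index.\<close>

lemma maximal_independent_cycles:
  assumes fin: "finite I" and cyc: "\<And>i. i \<in> I \<Longrightarrow> singular_relcycle (dg i) X {} (c i)"
  obtains J where "J \<subseteq> I" "independent_cycles X J dg c"
    and "\<And>k. k \<in> I - J \<Longrightarrow> \<exists>n. n k \<noteq> 0 \<and> singular_relboundary (dg k) X {}
           (\<Sum>i | i \<in> insert k J \<and> dg i = dg k. frag_cmul (n i) (c i))"
proof -
  let ?F = "{J. J \<subseteq> I \<and> independent_cycles X J dg c}"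
  have "finite ?F" "{} \<in> ?F"
    using fin by (auto simp: independent_cycles_def)
  then obtain J where J: "J \<in> ?F" and max: "\<And>J'. J' \<in> ?F \<Longrightarrow> J \<subseteq> J' \<Longrightarrow> J = J'"
    using finite_has_maximal2[of ?F "{}"] by auto
  then have "finite J" and indJ: "independent_cycles X J dg c"
    using fin finite_subset by auto
  have "\<exists>n. n k \<noteq> 0 \<and> singular_relboundary (dg k) X {}
           (\<Sum>i | i \<in> insert k J \<and> dg i = dg k. frag_cmul (n i) (c i))" if k: "k \<in> I - J" for k
  proof -
    have "insert k J \<notin> ?F"
      using max[of "insert k J"] k by blast
    have "\<exists>p n. singular_relboundary p X {} (\<Sum>i | i \<in> insert k J \<and> dg i = p. frag_cmul (n i) (c i))
        \<and> (\<exists>i\<in>insert k J. dg i = p \<and> n i \<noteq> 0)"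
    proof (rule ccontr)
      assume neg: "\<not> ?thesis"
      have "independent_cycles X (insert k J) dg c"
        unfolding independent_cycles_def
      proof (intro conjI ballI allI impI)
        show "singular_relcycle (dg i) X {} (c i)" if "i \<in> insert k J" for i
          using that J k cyc by auto
        show "n i = 0" if "singular_relboundary p X {} (\<Sum>i | i \<in> insert k J \<and> dg i = p. frag_cmul (n i) (c i))"
          and "i \<in> insert k J" "dg i = p" for p n i
        proof (rule ccontr)
          assume "n i \<noteq> 0"
          then have "\<exists>i\<in>insert k J. dg i = p \<and> n i \<noteq> 0"
            using that(2,3) by (intro bexI[of _ i] conjI)
          with that(1) show False
            using neg[unfolded not_ex, THEN spec, THEN spec, of p n] by simp
        qed
      qed (use \<open>finite J\<close> in simp)
      then show False
        using \<open>insert k J \<notin> ?F\<close> J k by simp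
    qed
    then obtain p n where bd: "singular_relboundary p X {}
          (\<Sum>i | i \<in> insert k J \<and> dg i = p. frag_cmul (n i) (c i))"
      and nz: "\<exists>i\<in>insert k J. dg i = p \<and> n i \<noteq> 0"
      by (elim exE conjE) (rule that)
    have "dg k = p \<and> n k \<noteq> 0"
    proof (rule ccontr)
      assume neg: "\<not> (dg k = p \<and> n k \<noteq> 0)"
      have "(\<Sum>i | i \<in> insert k J \<and> dg i = p. frag_cmul (n i) (c i))
          = (\<Sum>i | i \<in> J \<and> dg i = p. frag_cmul (n i) (c i))"
        by (rule sum.mono_neutral_right) (use neg \<open>finite J\<close> in auto)
      with bd have bdJ: "singular_relboundary p X {} (\<Sum>i | i \<in> J \<and> dg i = p. frag_cmul (n i) (c i))"
        by simp
      obtain i where "i \<in> insert k J" "dg i = p" "n i \<noteq> 0"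
        using nz by blast
      then show False
        using independent_cyclesD[OF indJ bdJ, of i] neg by auto
    qed
    then show ?thesis
      using bd by blast
  qed
  then show ?thesis
    using that J by blast
qed

text \<open>The space \<open>Z\<close> is a double: it consists of a half \<open>P\<close> and its mirror image \<open>N\<close>, glued along the wall
  \<open>P \<inter> N\<close>; the map \<open>\<phi>\<close> folds \<open>Z\<close> onto \<open>P\<close>, \<open>\<tau>\<close> is the reflection, and \<open>\<rho>\<close> collapses a collar of the
  wall in \<open>N\<close> onto the wall (\<open>U\<close> is the part of \<open>N\<close> outside the collar). The claim is that the total
  rank of homology does not drop from the wall to \<open>Z\<close>.

  A class of the wall either survives in \<open>P\<close>, and then it survives in \<open>Z\<close> because \<open>\<phi>\<close> retracts \<open>Z\<close> onto
  \<open>P\<close>; or it bounds a chain \<open>b\<close> in \<open>P\<close>, and then \<open>b - \<tau> b\<close> is a cycle of \<open>Z\<close> one degree higher, its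
  suspension. Folding kills all suspensions, so the surviving classes are independent of them. Modulo \<open>N\<close>
  a suspension is just \<open>b\<close>, and excision followed by \<open>\<rho>\<close> turns a relation between suspensions into a
  relation in \<open>(P, P \<inter> N)\<close>, whose boundary is a relation between the original classes of the wall.\<close>

lemma independent_cycles_double:
  fixes Z :: "'a topology" and P N U :: "'a set" and c :: "'i \<Rightarrow> 'a chain"
  assumes fold: "continuous_map Z (subtopology Z P) \<phi>" "\<And>x. x \<in> topspace Z \<inter> P \<Longrightarrow> \<phi> x = x"
    and mirror: "continuous_map (subtopology Z P) (subtopology Z N) \<tau>"
      "\<And>x. x \<in> topspace Z \<inter> P \<Longrightarrow> \<phi> (\<tau> x) = x"
      "\<And>x. x \<in> topspace Z \<inter> (P \<inter> N) \<Longrightarrow> \<tau> x = x"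
    and retr: "continuous_map (subtopology Z (- U)) (subtopology Z P) \<rho>"
      "\<And>x. x \<in> topspace Z \<inter> P \<Longrightarrow> \<rho> x = x"
      "\<And>x. x \<in> topspace Z \<inter> (N - U) \<Longrightarrow> \<rho> x \<in> P \<inter> N"
    and U: "Z closure_of U \<subseteq> Z interior_of N" "P \<inter> U = {}"
    and ind: "independent_cycles (subtopology Z (P \<inter> N)) I dg c"
  shows "\<exists>dg' c'. independent_cycles Z I dg' (c' :: 'i \<Rightarrow> 'a chain)"
proof -
  let ?P = "subtopology Z P" and ?A = "subtopology Z (P \<inter> N)"
  have finI: "finite I" and cycA: "\<And>i. i \<in> I \<Longrightarrow> singular_relcycle (dg i) ?A {} (c i)"
    using ind by (auto simp: independent_cycles_def)
  have cycP: "singular_relcycle (dg i) ?P {} (c i)" if "i \<in> I" for i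
    using singular_cycle_mono[OF cycA[OF that], of P] by auto
  have cycZ: "singular_relcycle (dg i) Z {} (c i)" if "i \<in> I" for i
    using singular_cycle_mono[OF cycA[OF that], of UNIV] by auto
  have chainA: "singular_chain q ?A (c i)" and chainP: "singular_chain q ?P (c i)"
    if "i \<in> I" "dg i = q" for i q
    using cycA[OF that(1)] cycP[OF that(1)] that(2) by (auto simp: singular_cycle)
  obtain J where J: "J \<subseteq> I" and indJ: "independent_cycles ?P J dg c"
    and dep: "\<And>k. k \<in> I - J \<Longrightarrow> \<exists>n. n k \<noteq> 0 \<and> singular_relboundary (dg k) ?P {}
           (\<Sum>i | i \<in> insert k J \<and> dg i = dg k. frag_cmul (n i) (c i))"
    by (rule maximal_independent_cycles[OF finI cycP]) (assumption, rule that)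
  have finJ: "finite J"
    using finI J finite_subset by blast
  have "\<forall>k\<in>I-J. \<exists>n b. n k \<noteq> 0 \<and> singular_chain (Suc (dg k)) ?P b \<and>
      chain_boundary (Suc (dg k)) b = (\<Sum>i | i \<in> insert k J \<and> dg i = dg k. frag_cmul (n i) (c i))"
  proof
    fix k assume "k \<in> I - J"
    from dep[OF this] obtain n where "n k \<noteq> 0"
      "singular_relboundary (dg k) ?P {} (\<Sum>i | i \<in> insert k J \<and> dg i = dg k. frag_cmul (n i) (c i))"
      by (elim exE conjE)
    then show "\<exists>n b. n k \<noteq> 0 \<and> singular_chain (Suc (dg k)) ?P b \<and>
      chain_boundary (Suc (dg k)) b = (\<Sum>i | i \<in> insert k J \<and> dg i = dg k. frag_cmul (n i) (c i))"
      unfolding singular_boundary by (intro exI[of _ n]) simp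
  qed
  from bchoice[OF this] obtain n where n: "\<forall>k\<in>I-J. \<exists>b. n k k \<noteq> 0 \<and> singular_chain (Suc (dg k)) ?P b \<and>
      chain_boundary (Suc (dg k)) b = (\<Sum>i | i \<in> insert k J \<and> dg i = dg k. frag_cmul (n k i) (c i))" ..
  from bchoice[OF this] obtain b where nb: "\<forall>k\<in>I-J. n k k \<noteq> 0 \<and> singular_chain (Suc (dg k)) ?P (b k) \<and>
      chain_boundary (Suc (dg k)) (b k) = (\<Sum>i | i \<in> insert k J \<and> dg i = dg k. frag_cmul (n k i) (c i))" ..
  have nk: "n k k \<noteq> 0" and b: "singular_chain (Suc (dg k)) ?P (b k)"
    and db: "chain_boundary (Suc (dg k)) (b k)
        = (\<Sum>i | i \<in> insert k J \<and> dg i = dg k. frag_cmul (n k i) (c i))" if "k \<in> I-J" for k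
    using bspec[OF nb that] by simp_all
  define w where "w k = b k - chain_map (Suc (dg k)) \<tau> (b k)" for k
  define dg' where "dg' i = (if i \<in> J then dg i else Suc (dg i))" for i
  define c' where "c' i = (if i \<in> J then c i else w i)" for i
  have mirror_Z: "continuous_map ?P Z \<tau>"
    using mirror(1) continuous_map_into_fulltopology by blast
  have id_Z: "continuous_map ?P Z id"
    by (simp add: continuous_map_from_subtopology)
  have dbA: "singular_chain (dg k) ?A (chain_boundary (Suc (dg k)) (b k))" if k: "k \<in> I-J" for k
    unfolding db[OF k] using k J
    by (intro singular_chain_sum singular_chain_cmul chainA) auto
  \<comment> \<open>The boundary of \<open>b k\<close> lies in the wall, where the reflection is the identity, so it cancels.\<close>
  have wZ: "singular_relcycle (Suc (dg k)) Z {} (w k)" if k: "k \<in> I-J" for k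
  proof -
    have "chain_map (dg k) \<tau> (chain_boundary (Suc (dg k)) (b k)) = chain_boundary (Suc (dg k)) (b k)"
      by (rule chain_map_id_gen[OF dbA[OF k]]) (use mirror(3) in auto)
    moreover have "singular_chain (Suc (dg k)) Z (b k)"
      using singular_chain_mono[of _ Z P "b k" UNIV] b[OF k] by simp
    ultimately show ?thesis
      using b[OF k] singular_chain_chain_map[OF b[OF k] mirror_Z]
      by (simp add: w_def singular_cycle singular_chain_diff chain_boundary_diff
          chain_boundary_chain_map[OF b[OF k]])
  qed
  have fold_w: "chain_map (Suc (dg k)) \<phi> (w k) = 0" if k: "k \<in> I-J" for k
  proof -
    have "chain_map (Suc (dg k)) \<phi> (chain_map (Suc (dg k)) \<tau> (b k)) = b k"
      using chain_map_id_gen[OF b[OF k], of "\<phi> \<circ> \<tau>"] mirror(2)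
      by (simp add: chain_map_compose)
    moreover have "chain_map (Suc (dg k)) \<phi> (b k) = b k"
      by (rule chain_map_id_gen[OF b[OF k]]) (use fold(2) in auto)
    ultimately show ?thesis
      by (simp add: w_def chain_map_diff)
  qed
  have "independent_cycles Z I dg' c'"
    unfolding independent_cycles_def
  proof (intro conjI allI impI)
    show "\<forall>i\<in>I. singular_relcycle (dg' i) Z {} (c' i)"
      using cycZ wZ J by (auto simp: dg'_def c'_def)
  next
    fix p m
    assume bd: "singular_relboundary p Z {} (\<Sum>i | i \<in> I \<and> dg' i = p. frag_cmul (m i) (c' i))"
    define DJ where "DJ = {i. i \<in> J \<and> dg i = p}"
    define DK where "DK = {k. k \<in> I-J \<and> Suc (dg k) = p}"
    define SJ where "SJ = (\<Sum>i\<in>DJ. frag_cmul (m i) (c i))"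
    define SK where "SK = (\<Sum>k\<in>DK. frag_cmul (m k) (w k))"
    have fin: "finite DJ" "finite DK"
      using finI finJ by (auto simp: DJ_def DK_def)
    have split: "{i. i \<in> I \<and> dg' i = p} = DJ \<union> DK" and disj: "DJ \<inter> DK = {}"
      using J by (auto simp: DJ_def DK_def dg'_def)
    have "(\<Sum>i | i \<in> I \<and> dg' i = p. frag_cmul (m i) (c' i)) = SJ + SK"
      unfolding split sum.union_disjoint[OF fin disj] SJ_def SK_def
      by (intro arg_cong2[where f = "(+)"] sum.cong) (auto simp: DJ_def DK_def c'_def)
    with bd have bdS: "singular_relboundary p Z {} (SJ + SK)"
      by simp
    \<comment> \<open>Folding isolates the part of the relation that lives in \<open>P\<close>.\<close>
    have "chain_map p \<phi> SK = 0"
      using fin fold_w by (auto simp: SK_def chain_map_sum DK_def intro!: sum.neutral)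
    moreover have "chain_map p \<phi> SJ = SJ"
    proof (rule chain_map_id_gen)
      show "singular_chain p ?P SJ"
        unfolding SJ_def using J
        by (intro singular_chain_sum singular_chain_cmul chainP) (auto simp: DJ_def)
    qed (use fold(2) in auto)
    ultimately have "singular_relboundary p ?P {} SJ"
      using singular_relboundary_chain_map[OF bdS fold(1), of "{}"] by (simp add: chain_map_add)
    then have mJ: "m i = 0" if "i \<in> DJ" for i
      using independent_cyclesD[OF indJ, of p m] that by (auto simp: SJ_def DJ_def)
    then have "SJ = 0"
      by (simp add: SJ_def)
    then have bdK: "singular_relboundary p Z {} SK"
      using bdS by simp
    have mK: "m i = 0" if i: "i \<in> DK" for i
    proof -
      obtain q where p: "p = Suc q"
        using i by (auto simp: DK_def)
      define B where "B = (\<Sum>k\<in>DK. frag_cmul (m k) (b k))"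
      have BP: "singular_chain p ?P B"
        unfolding B_def using b by (intro singular_chain_sum singular_chain_cmul) (auto simp: DK_def)
      have dB: "chain_boundary p B = (\<Sum>k\<in>DK. frag_cmul (m k) (chain_boundary p (b k)))"
        by (simp add: B_def chain_boundary_sum chain_boundary_cmul o_def)
      have dBA: "singular_chain q ?A (chain_boundary p B)"
        unfolding dB using dbA by (intro singular_chain_sum singular_chain_cmul) (auto simp: DK_def p)
      have SK: "SK = B - chain_map p \<tau> B"
      proof -
        have "SK = (\<Sum>k\<in>DK. frag_cmul (m k) (b k) - frag_cmul (m k) (chain_map p \<tau> (b k)))"
          unfolding SK_def by (rule sum.cong) (auto simp: w_def DK_def frag_cmul_diff_distrib2)
        then show ?thesis
          using fin by (simp add: B_def chain_map_sum o_def sum_subtractf)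
      qed
      \<comment> \<open>The mirror image of \<open>B\<close> lies in \<open>N\<close> and disappears modulo \<open>N\<close>.\<close>
      have "singular_relboundary p Z N B"
      proof -
        have "singular_chain p (subtopology Z N) (chain_map p \<tau> B)"
          using singular_chain_chain_map[OF BP mirror(1)] .
        moreover obtain d where "singular_chain (Suc p) Z d" "chain_boundary (Suc p) d = SK"
          using bdK by (auto simp: singular_boundary)
        ultimately show ?thesis
          unfolding singular_relboundary SK by force
      qed
      moreover have "singular_relcycle p (subtopology Z (UNIV - U)) (N - U) B"
        unfolding singular_relcycle
      proof
        show "singular_chain p (subtopology Z (UNIV - U)) B"
          by (rule singular_chain_mono[OF BP]) (use U(2) in auto)
        have "singular_chain q (subtopology Z ((UNIV - U) \<inter> (N - U))) (chain_boundary p B)"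
          by (rule singular_chain_mono[OF dBA]) (use U(2) in auto)
        then show "singular_chain (p - 1) (subtopology (subtopology Z (UNIV - U)) (N - U)) (chain_boundary p B)"
          by (simp add: subtopology_subtopology p)
      qed
      ultimately have "singular_relboundary p (subtopology Z (UNIV - U)) (N - U) B"
        using excision_reflects_relboundary[OF U(1), of UNIV p B] by simp
      moreover have restr: "topspace (subtopology Z (- U)) \<inter> (N - U) = topspace Z \<inter> (N - U)"
        by auto
      ultimately have "singular_relboundary p (subtopology Z (- U)) (topspace Z \<inter> (N - U)) B"
        using singular_relboundary_restrict[of p "subtopology Z (- U)" "N - U"] restr
        by (simp add: Compl_eq_Diff_UNIV)
      then have "singular_relboundary p ?P (P \<inter> N) (chain_map p \<rho> B)"
        by (rule singular_relboundary_chain_map[OF _ retr(1)]) (use retr(3) in auto)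
      moreover have "chain_map p \<rho> B = B"
        by (rule chain_map_id_gen[OF BP]) (use retr(2) in auto)
      ultimately obtain d e where d: "singular_chain (Suc p) ?P d"
        and e: "singular_chain p (subtopology ?P (P \<inter> N)) e" and B: "B = chain_boundary (Suc p) d + e"
        by (auto simp: singular_relboundary)
      have "chain_boundary p B = chain_boundary p e"
        using chain_boundary_boundary_alt[OF d] by (simp add: B chain_boundary_add)
      moreover have "singular_chain p ?A e"
        using e by (simp add: subtopology_subtopology)
      ultimately have bdA: "singular_relboundary q ?A {} (chain_boundary p B)"
        unfolding singular_boundary p by metis
      \<comment> \<open>The boundary of \<open>B\<close>, expanded in the given family. Since \<open>J\<close> is shared by all relations but each
          \<open>k\<close> in \<open>DK\<close> occurs in its own relation only, the coefficient at such a \<open>k\<close> is \<open>m k * n k k\<close>.\<close>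
      define N' where "N' i = (\<Sum>k\<in>DK. if i \<in> insert k J then m k * n k i else 0)" for i
      let ?Iq = "{i. i \<in> I \<and> dg i = q}"
      have "chain_boundary p B
          = (\<Sum>k\<in>DK. \<Sum>i\<in>?Iq. frag_cmul (if i \<in> insert k J then m k * n k i else 0) (c i))"
        unfolding dB
      proof (rule sum.cong[OF refl])
        fix k assume k: "k \<in> DK"
        then have "chain_boundary p (b k) = (\<Sum>i | i \<in> insert k J \<and> dg i = q. frag_cmul (n k i) (c i))"
          using db by (auto simp: DK_def p)
        then have "frag_cmul (m k) (chain_boundary p (b k))
            = (\<Sum>i | i \<in> insert k J \<and> dg i = q. frag_cmul (m k * n k i) (c i))"
          by (simp add: frag_cmul_sum)
        also have "\<dots> = (\<Sum>i\<in>?Iq. frag_cmul (if i \<in> insert k J then m k * n k i else 0) (c i))"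
          by (rule sum.mono_neutral_cong_left) (use finI J k in \<open>auto simp: DK_def\<close>)
        finally show "frag_cmul (m k) (chain_boundary p (b k)) = \<dots>" .
      qed
      also have "\<dots> = (\<Sum>i\<in>?Iq. frag_cmul (N' i) (c i))"
        by (subst sum.swap) (simp add: N'_def frag_cmul_sum_left)
      finally have "chain_boundary p B = (\<Sum>i\<in>?Iq. frag_cmul (N' i) (c i))" .
      then have "N' i = 0"
        using independent_cyclesD[OF ind, of q N' i] bdA i by (auto simp: DK_def p)
      moreover have "N' i = m i * n i i"
      proof -
        have "N' i = (\<Sum>k\<in>DK. if k = i then m i * n i i else 0)"
          unfolding N'_def by (rule sum.cong) (use i in \<open>auto simp: DK_def\<close>)
        then show ?thesis
          using fin i by simp
      qed
      ultimately show ?thesis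
        using nk[of i] i by (auto simp: DK_def)
    qed
    show "\<forall>i\<in>I. dg' i = p \<longrightarrow> m i = 0"
      using mJ mK split by blast
  qed (rule finI)
  then show ?thesis by blast
qed


section \<open>From independent cycles to rational cohomology\<close>

text \<open>\<open>\<rat>\<close> is an injective abelian group: a homomorphism to \<open>\<rat>\<close> that kills a subgroup \<open>G\<close> of the chains can be
  prescribed on \<open>c\<close> as soon as no nonzero multiple of \<open>c\<close> lies in \<open>G\<close>. Integral chains are embedded
  in the rational vector space of all functions on simplices; clearing denominators shows that \<open>c\<close>
  stays outside the rational span of \<open>G\<close>, and a linear functional is then built on a basis.\<close>

lemma rational_functional_separating:
  fixes G :: "'a chain set" and c :: "'a chain"
  assumes zero: "0 \<in> G" and add: "\<And>g h. g \<in> G \<Longrightarrow> h \<in> G \<Longrightarrow> g + h \<in> G"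
    and cmul: "\<And>n g. g \<in> G \<Longrightarrow> frag_cmul n g \<in> G"
    and sep: "\<And>n. n \<noteq> 0 \<Longrightarrow> frag_cmul n c \<notin> G"
  obtains f :: "'a cochain" where "\<And>g. g \<in> G \<Longrightarrow> cochain_eval f g = 0" "cochain_eval f c = 1"
proof -
  define scl :: "rat \<Rightarrow> 'a cochain \<Rightarrow> 'a cochain" where "scl q f = (\<lambda>s. q * f s)" for q f
  define \<iota> :: "'a chain \<Rightarrow> 'a cochain" where "\<iota> c = (\<lambda>s. of_int (Poly_Mapping.lookup c s))" for c
  interpret V: vector_space scl
    by unfold_locales (auto simp: scl_def algebra_simps)
  interpret VP: vector_space_pair scl "(*) :: rat \<Rightarrow> rat \<Rightarrow> rat"
    by unfold_locales (auto simp: algebra_simps)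
  have \<iota>_add: "\<iota> (a + b) = \<iota> a + \<iota> b" for a b
    by (auto simp: \<iota>_def lookup_add)
  have \<iota>_cmul: "\<iota> (frag_cmul n a) = scl (of_int n) (\<iota> a)" for n a
    by (auto simp: \<iota>_def scl_def)
  have \<iota>_zero: "\<iota> 0 = 0"
    by (auto simp: \<iota>_def)
  have \<iota>_inj: "a = b" if "\<iota> a = \<iota> b" for a b
    using that by (auto simp: \<iota>_def fun_eq_iff intro: poly_mapping_eqI)
  \<comment> \<open>A subspace containing the rational span of \<open>G\<close>, described by clearing denominators.\<close>
  define W where "W = {x. \<exists>n g. n \<noteq> 0 \<and> g \<in> G \<and> scl (of_int n) x = \<iota> g}"
  have sub: "V.subspace W"
  proof (rule V.subspaceI)
    show "0 \<in> W"
      unfolding W_def using zero \<iota>_zero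
      by (intro CollectI exI[of _ "1 :: int"] exI[of _ "0 :: 'a chain"]) simp
  next
    fix x y assume "x \<in> W" "y \<in> W"
    then obtain n g n' g' where *: "n \<noteq> 0" "g \<in> G" "scl (of_int n) x = \<iota> g"
      "n' \<noteq> 0" "g' \<in> G" "scl (of_int n') y = \<iota> g'"
      by (auto simp: W_def)
    have "scl (of_int (n * n')) (x + y) = scl (of_int n') (scl (of_int n) x) + scl (of_int n) (scl (of_int n') y)"
      by (simp add: V.scale_right_distrib mult.commute)
    also have "\<dots> = \<iota> (frag_cmul n' g + frag_cmul n g')"
      using * by (simp add: \<iota>_add \<iota>_cmul)
    finally show "x + y \<in> W"
      using * add cmul unfolding W_def
      by (intro CollectI exI[of _ "n * n'"] exI[of _ "frag_cmul n' g + frag_cmul n g'"]) auto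
  next
    fix q x assume "x \<in> W"
    then obtain n g where *: "n \<noteq> 0" "g \<in> G" "scl (of_int n) x = \<iota> g"
      by (auto simp: W_def)
    obtain u v where "quotient_of q = (u, v)"
      by (cases "quotient_of q")
    then have q: "q = of_int u / of_int v" "v > 0"
      using quotient_of_div quotient_of_denom_pos by auto
    have "scl (of_int (n * v)) (scl q x) = scl (of_int u) (scl (of_int n) x)"
      using q by (simp add: mult.commute)
    also have "\<dots> = \<iota> (frag_cmul u g)"
      using * by (simp add: \<iota>_cmul)
    finally show "scl q x \<in> W"
      using * q cmul unfolding W_def
      by (intro CollectI exI[of _ "n * v"] exI[of _ "frag_cmul u g"]) auto
  qed
  obtain B where B: "B \<subseteq> W" "V.independent B" "W \<subseteq> V.span B"
    using V.maximal_independent_subset by blast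
  have "\<iota> c \<notin> W"
  proof
    assume "\<iota> c \<in> W"
    then obtain n g where *: "n \<noteq> 0" "g \<in> G" "\<iota> (frag_cmul n c) = \<iota> g"
      by (auto simp: W_def \<iota>_cmul)
    then show False
      using \<iota>_inj sep by metis
  qed
  then have "V.independent (insert (\<iota> c) B)" "\<iota> c \<notin> B"
    using B V.span_minimal[OF B(1) sub] by (auto simp: V.independent_insert)
  then obtain \<psi> where \<psi>: "Vector_Spaces.linear scl (*) \<psi>"
    and vals: "\<forall>x\<in>insert (\<iota> c) B. \<psi> x = (if x = \<iota> c then 1 else 0)"
    using VP.linear_independent_extend[of "insert (\<iota> c) B" "\<lambda>x. if x = \<iota> c then 1 else 0"] by blast
  have \<psi>B: "\<psi> x = 0" if "x \<in> B" for x
    using vals that \<open>\<iota> c \<notin> B\<close> by auto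
  have \<psi>c: "\<psi> (\<iota> c) = 1"
    using vals by simp
  interpret \<psi>: Vector_Spaces.linear scl "(*)" \<psi>
    by (rule \<psi>)
  have \<psi>W: "\<psi> x = 0" if "x \<in> W" for x
    using \<psi>.eq_0_on_span[OF \<psi>B] that B(3) by blast
  define f where "f s = \<psi> (\<iota> (frag_of s))" for s
  have f: "cochain_eval f a = \<psi> (\<iota> a)" for a
    using subset_UNIV[of "Poly_Mapping.keys a"]
  proof (induction a rule: frag_induction)
    case (diff a b)
    have "\<iota> (a - b) = \<iota> a - \<iota> b"
      by (auto simp: \<iota>_def lookup_minus)
    with diff show ?case
      by (simp only: cochain_eval_diff \<psi>.diff)
  next
    case zero
    show ?case
      by (simp only: cochain_eval_zero \<iota>_zero \<psi>.zero)
  qed (simp add: f_def)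
  show ?thesis
  proof
    show "cochain_eval f g = 0" if "g \<in> G" for g
      unfolding f using that by (intro \<psi>W) (auto simp: W_def intro!: exI[of _ 1])
    show "cochain_eval f c = 1"
      by (simp add: f \<psi>c)
  qed
qed

text \<open>A cocycle is a homomorphism that kills boundaries, so the subgroup to be killed is spanned by
  the boundaries and by the other members of the family.\<close>

lemma dual_cocycle_exists:
  assumes fin: "finite I" and j: "j \<in> I"
    and c: "\<And>i. i \<in> I \<Longrightarrow> singular_chain p X (c i)"
    and ind: "\<And>n. singular_relboundary p X {} (\<Sum>i\<in>I. frag_cmul (n i) (c i)) \<Longrightarrow> n j = 0"
  shows "\<exists>f \<in> singular_cocycle_set p X. \<forall>i\<in>I. cochain_eval f (c i) = (if i = j then 1 else 0)"
proof -
  define G where "G = {d + (\<Sum>i\<in>I-{j}. frag_cmul (n i) (c i)) |d n. singular_relboundary p X {} d}"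
  have G: "d + (\<Sum>i\<in>I-{j}. frag_cmul (n i) (c i)) \<in> G" if "singular_relboundary p X {} d" for d n
    using that by (auto simp: G_def)
  obtain f where fG: "\<And>g. g \<in> G \<Longrightarrow> cochain_eval f g = 0" and fc: "cochain_eval f (c j) = 1"
  proof (rule rational_functional_separating[of G "c j"])
    show "0 \<in> G"
      using G[of 0 "\<lambda>_. 0"] by simp
  next
    fix g h assume "g \<in> G" "h \<in> G"
    then obtain d n d' n' where *: "singular_relboundary p X {} d" "singular_relboundary p X {} d'"
      "g = d + (\<Sum>i\<in>I-{j}. frag_cmul (n i) (c i))" "h = d' + (\<Sum>i\<in>I-{j}. frag_cmul (n' i) (c i))"
      unfolding G_def by blast
    then show "g + h \<in> G"
      using G[of "d + d'" "\<lambda>i. n i + n' i"] singular_relboundary_add[of p X "{}" d d']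
      by (simp add: frag_cmul_distrib sum.distrib add_ac)
  next
    fix k g assume "g \<in> G"
    then obtain d n where *: "singular_relboundary p X {} d" "g = d + (\<Sum>i\<in>I-{j}. frag_cmul (n i) (c i))"
      unfolding G_def by blast
    then show "frag_cmul k g \<in> G"
      using G[of "frag_cmul k d" "\<lambda>i. k * n i"] singular_relboundary_cmul[of p X "{}" d k]
      by (simp add: frag_cmul_distrib2 frag_cmul_sum)
  next
    fix k :: int assume k: "k \<noteq> 0"
    show "frag_cmul k (c j) \<notin> G"
    proof
      assume "frag_cmul k (c j) \<in> G"
      then obtain d n where *: "singular_relboundary p X {} d"
        "frag_cmul k (c j) = d + (\<Sum>i\<in>I-{j}. frag_cmul (n i) (c i))"
        unfolding G_def by blast
      let ?n = "\<lambda>i. if i = j then k else - n i"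
      have "(\<Sum>i\<in>I. frag_cmul (?n i) (c i))
          = frag_cmul k (c j) + (\<Sum>i\<in>I-{j}. frag_cmul (?n i) (c i))"
        using fin j by (simp add: sum.remove)
      also have "(\<Sum>i\<in>I-{j}. frag_cmul (?n i) (c i)) = (\<Sum>i\<in>I-{j}. - frag_cmul (n i) (c i))"
        by (rule sum.cong) auto
      also have "\<dots> = - (\<Sum>i\<in>I-{j}. frag_cmul (n i) (c i))"
        by (rule sum_negf)
      finally have "(\<Sum>i\<in>I. frag_cmul (?n i) (c i)) = d"
        unfolding *(2) by simp
      then show False
        using ind[of ?n] *(1) k by simp
    qed
  qed blast
  \<comment> \<open>Cochains vanish off the singular simplices of \<open>X\<close> by convention.\<close>
  define f' where "f' s = (if singular_simplex p X s then f s else 0)" for s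
  have f': "cochain_eval f' a = cochain_eval f a" if "singular_chain p X a" for a
    unfolding cochain_eval_def using that
    by (intro sum.cong) (auto simp: f'_def singular_chain_def)
  have "f' \<in> singular_cocycle_set p X"
  proof -
    have "coboundary p X f' s = 0" for s
    proof (cases "singular_simplex (Suc p) X s")
      case True
      then have s: "singular_chain (Suc p) X (frag_of s)"
        by (simp add: singular_chain_of)
      then have "singular_relboundary p X {} (chain_boundary (Suc p) (frag_of s))"
        by (auto simp: singular_boundary)
      from G[OF this, of "\<lambda>_. 0"] have "chain_boundary (Suc p) (frag_of s) \<in> G"
        by simp
      then show ?thesis
        using fG f'[OF singular_chain_boundary_alt[OF s]] True by (simp add: coboundary_def)
    qed (simp add: coboundary_def)
    then show ?thesis
      by (auto simp: singular_cocycle_set_def singular_cochain_set_def f'_def fun_eq_iff)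
  qed
  moreover have "cochain_eval f' (c i) = (if i = j then 1 else 0)" if i: "i \<in> I" for i
  proof (cases "i = j")
    case False
    have "(\<Sum>k\<in>I-{j}. frag_cmul (if k = i then 1 else 0) (c k)) = (\<Sum>k\<in>I-{j}. if k = i then c k else 0)"
      by (rule sum.cong) auto
    then have "c i \<in> G"
      using G[of 0 "\<lambda>k. if k = i then 1 else 0"] fin i False by simp
    then show ?thesis
      using fG f' c i False by simp
  qed (use f' c i fc in simp)
  ultimately show ?thesis by blast
qed

lemma cochain_eval_coboundary_set:
  assumes "f \<in> singular_coboundary_set p X" "singular_relcycle p X {} c"
  shows "cochain_eval f c = 0"
proof (cases p)
  case 0
  then show ?thesis
    using assms by (auto simp: singular_coboundary_set_def cochain_eval_zero_left)
next
  case (Suc r)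
  then show ?thesis
    using assms by (auto simp: singular_coboundary_set_def singular_cycle cochain_eval_coboundary)
qed

text \<open>Evaluation on a cycle is well defined on cohomology classes, so a Kronecker-dual system of
  cocycles is independent in cohomology: evaluating a relation on the cycles recovers its coefficients.\<close>

lemma vs_dim_cohomology_ge:
  assumes fin: "finite I"
    and cyc: "\<And>i. i \<in> I \<Longrightarrow> singular_relcycle p X {} (c i)"
    and f: "\<And>j. j \<in> I \<Longrightarrow> f j \<in> singular_cocycle_set p X"
    and dual: "\<And>i j. i \<in> I \<Longrightarrow> j \<in> I \<Longrightarrow> cochain_eval (f j) (c i) = (if i = j then 1 else 0)"
  shows "enat (card I) \<le> vs_dim rat_field (cohomology p X)"
proof -
  let ?Z = "(cochain_module p X)\<lparr>carrier := singular_cocycle_set p X\<rparr>"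
  let ?W = "singular_coboundary_set p X" and ?H = "cohomology p X"
  interpret Z: module rat_field ?Z
    by (rule submodule.submodule_is_module[OF submodule_cocycle]) (rule module_cochain_module)
  have "subgroup ?W (add_monoid ?Z)"
    using submodule_coboundary[of p X] by (simp add: submodule_def)
  then interpret W: abelian_subgroup ?W ?Z
    by (intro abelian_subgroupI3) (auto intro: additive_subgroupI Z.abelian_group_axioms)
  interpret H: module rat_field ?H
    by (rule module_cohomology)
  define cl where "cl g = ?W +>\<^bsub>?Z\<^esub> g" for g
  have cl_closed: "cl g \<in> carrier ?H" if "g \<in> singular_cocycle_set p X" for g
    using that Z.a_rcosetsI[OF W.a_subset] by (simp add: cohomology_def quotient_module_def cl_def)
  have cl_add: "cl g \<oplus>\<^bsub>?H\<^esub> cl h = cl (\<lambda>s. g s + h s)"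
    if "g \<in> singular_cocycle_set p X" "h \<in> singular_cocycle_set p X" for g h
    using W.a_rcos_sum[of g h] that
    by (simp add: cohomology_def quotient_module_def cl_def) (simp add: cochain_module_def)
  have cl_smult: "q \<odot>\<^bsub>?H\<^esub> cl g = cl (\<lambda>s. q * g s)" if "g \<in> singular_cocycle_set p X" for q g
    using Z.quotient_smult_coset[OF submodule_coboundary, of q g] that
    by (simp add: cohomology_def quotient_module_def cl_def rat_field_def)
      (simp add: cochain_module_def)
  have cl_eval: "cochain_eval g (c i) = cochain_eval h (c i)"
    if gh: "g \<in> singular_cocycle_set p X" "cl g = cl h" and i: "i \<in> I" for g h i
  proof -
    have "g \<in> cl h"
      using W.a_rcos_self[of g] gh by (simp add: cl_def)
    then obtain u where "u \<in> ?W" "g = (\<lambda>s. u s + h s)"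
      by (auto simp: cl_def a_r_coset_def') (auto simp: cochain_module_def)
    then show ?thesis
      using cochain_eval_coboundary_set[of u p X "c i"] cyc i by (simp add: cochain_eval_plus_left)
  qed
  have zero_cocycle: "(\<lambda>_. 0) \<in> singular_cocycle_set p X"
    by (auto simp: singular_cocycle_set_def singular_cochain_set_def coboundary_zero)
  have cl_zero: "\<zero>\<^bsub>?H\<^esub> = cl (\<lambda>_. 0)"
    using Z.a_coset_add_zero[OF W.a_subset]
    by (simp add: cohomology_def quotient_module_def cl_def) (simp add: cochain_module_def)
  have sum_cocycle: "(\<lambda>s. \<Sum>j\<in>J. a j * f j s) \<in> singular_cocycle_set p X" if "J \<subseteq> I" for J a
    using finite_subset[OF that fin] that
  proof (induction J rule: finite_induct)
    case (insert j J)
    have "(\<lambda>s. a j * f j s) \<in> singular_cocycle_set p X"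
      using insert f by (auto simp: singular_cocycle_set_def singular_cochain_set_def coboundary_cmul)
    then show ?case
      using insert by (auto simp: singular_cocycle_set_def singular_cochain_set_def coboundary_add)
  qed (simp add: zero_cocycle)
  \<comment> \<open>Passing to classes is linear; this moves a relation in the quotient back to cocycles.\<close>
  have sum_cl: "(\<Oplus>\<^bsub>?H\<^esub>j\<in>J. a j \<odot>\<^bsub>?H\<^esub> cl (f j)) = cl (\<lambda>s. \<Sum>j\<in>J. a j * f j s)"
    if "J \<subseteq> I" for J a
    using finite_subset[OF that fin] that
  proof (induction J rule: finite_induct)
    case (insert j J)
    have aj: "(\<lambda>s. a j * f j s) \<in> singular_cocycle_set p X"
      using insert f by (auto simp: singular_cocycle_set_def singular_cochain_set_def coboundary_cmul)
    have "a k \<odot>\<^bsub>?H\<^esub> cl (f k) \<in> carrier ?H" if "k \<in> insert j J" for k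
      using that insert.prems f cl_closed by (intro H.smult_closed) (auto simp: rat_field_def)
    then have "(\<Oplus>\<^bsub>?H\<^esub>j\<in>insert j J. a j \<odot>\<^bsub>?H\<^esub> cl (f j))
        = a j \<odot>\<^bsub>?H\<^esub> cl (f j) \<oplus>\<^bsub>?H\<^esub> (\<Oplus>\<^bsub>?H\<^esub>j\<in>J. a j \<odot>\<^bsub>?H\<^esub> cl (f j))"
      using insert.hyps by (intro H.finsum_insert) auto
    also have "\<dots> = cl (\<lambda>s. a j * f j s) \<oplus>\<^bsub>?H\<^esub> cl (\<lambda>s. \<Sum>j\<in>J. a j * f j s)"
      using insert f by (simp add: cl_smult)
    also have "\<dots> = cl (\<lambda>s. \<Sum>j\<in>insert j J. a j * f j s)"
      using insert aj sum_cocycle[of J a] by (simp add: cl_add)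
    finally show ?case .
  qed (simp add: cl_zero)
  have eval_sum: "cochain_eval (\<lambda>s. \<Sum>j\<in>I. a j * f j s) (c i) = a i" if i: "i \<in> I" for a i
  proof -
    have "cochain_eval (\<lambda>s. \<Sum>j\<in>I. a j * f j s) (c i) = (\<Sum>j\<in>I. a j * cochain_eval (f j) (c i))"
      unfolding cochain_eval_def sum_distrib_left
      by (subst sum.swap) (simp add: mult_ac)
    also have "\<dots> = (\<Sum>j\<in>I. if j = i then a i else 0)"
      by (rule sum.cong) (auto simp: dual i)
    finally show ?thesis
      using fin i by simp
  qed
  have inj: "inj_on (cl \<circ> f) I"
  proof (rule inj_onI)
    fix i j assume ij: "i \<in> I" "j \<in> I" "(cl \<circ> f) i = (cl \<circ> f) j"
    then have "cochain_eval (f i) (c i) = cochain_eval (f j) (c i)"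
      using cl_eval[of "f i" "f j" i] f by simp
    then show "i = j"
      using ij dual by (auto split: if_splits)
  qed
  have "finite_lin_indep rat_field ?H ((cl \<circ> f) ` I)"
    unfolding finite_lin_indep_def
  proof (intro conjI ballI impI)
    show "finite ((cl \<circ> f) ` I)" "(cl \<circ> f) ` I \<subseteq> carrier ?H"
      using fin f cl_closed by auto
  next
    fix a v assume a: "(\<Oplus>\<^bsub>?H\<^esub>v\<in>(cl \<circ> f) ` I. a v \<odot>\<^bsub>?H\<^esub> v) = \<zero>\<^bsub>?H\<^esub>"
      and v: "v \<in> (cl \<circ> f) ` I"
    then obtain i where i: "i \<in> I" "v = cl (f i)"
      by auto
    let ?a = "\<lambda>i. a (cl (f i))"
    have pi: "(\<lambda>v. a v \<odot>\<^bsub>?H\<^esub> v) \<in> (cl \<circ> f) ` I \<rightarrow> carrier ?H"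
      using f cl_closed by (intro funcsetI H.smult_closed) (auto simp: rat_field_def)
    have "(\<Oplus>\<^bsub>?H\<^esub>v\<in>(cl \<circ> f) ` I. a v \<odot>\<^bsub>?H\<^esub> v) = (\<Oplus>\<^bsub>?H\<^esub>i\<in>I. ?a i \<odot>\<^bsub>?H\<^esub> cl (f i))"
      using H.finsum_reindex[OF pi inj] by (simp add: o_def)
    then have "cl (\<lambda>s. \<Sum>j\<in>I. ?a j * f j s) = cl (\<lambda>_. 0)"
      using a sum_cl[of I ?a] cl_zero by simp
    then have "cochain_eval (\<lambda>s. \<Sum>j\<in>I. ?a j * f j s) (c i) = 0"
      using cl_eval[OF sum_cocycle[of I ?a] _ i(1), of "\<lambda>_. 0"] by (simp add: cochain_eval_zero_left)
    then show "a v = \<zero>\<^bsub>rat_field\<^esub>"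
      using eval_sum[OF i(1), of ?a] i by (simp add: rat_field_def)
  qed
  then have "enat (card ((cl \<circ> f) ` I)) \<le> vs_dim rat_field ?H"
    unfolding vs_dim_def by (intro SUP_upper) auto
  then show ?thesis
    by (simp only: card_image[OF inj])
qed

text \<open>Only finitely many degrees occur in the family, so a finite partial sum of the series suffices;
  infinite-dimensional cohomology causes no trouble, since dimensions are extended naturals.\<close>

lemma card_le_hrk:
  assumes "independent_cycles X I dg c"
  shows "enat (card I) \<le> hrk X"
proof -
  have fin: "finite I"
    using assms by (simp add: independent_cycles_def)
  have dim: "enat (card {i. i \<in> I \<and> dg i = p}) \<le> vs_dim rat_field (cohomology p X)" for p
  proof -
    let ?I = "{i. i \<in> I \<and> dg i = p}"
    have cyc: "singular_relcycle p X {} (c i)" if "i \<in> ?I" for i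
      using assms that by (auto simp: independent_cycles_def)
    have "\<exists>f \<in> singular_cocycle_set p X. \<forall>i\<in>?I. cochain_eval f (c i) = (if i = j then 1 else 0)"
      if j: "j \<in> ?I" for j
    proof (rule dual_cocycle_exists[OF _ j])
      show "n j = 0" if "singular_relboundary p X {} (\<Sum>i\<in>?I. frag_cmul (n i) (c i))" for n
        using independent_cyclesD[OF assms that] j by auto
    qed (use fin cyc in \<open>auto simp: singular_relcycle\<close>)
    then have "\<forall>j\<in>?I. \<exists>f. f \<in> singular_cocycle_set p X \<and>
        (\<forall>i\<in>?I. cochain_eval f (c i) = (if i = j then 1 else 0))"
      by (simp only: Bex_def) blast
    from bchoice[OF this] obtain f where f: "\<forall>j\<in>?I. f j \<in> singular_cocycle_set p X \<and>
        (\<forall>i\<in>?I. cochain_eval (f j) (c i) = (if i = j then 1 else 0))" ..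
    show ?thesis
      by (rule vs_dim_cohomology_ge[of ?I p X c f]) (use fin cyc f in simp_all)
  qed
  have "card I = (\<Sum>p\<in>dg ` I. card {i. i \<in> I \<and> dg i = p})"
    using sum.image_gen[OF fin, of "\<lambda>_. 1 :: nat" dg] by simp
  then have "enat (card I) = (\<Sum>p\<in>dg ` I. enat (card {i. i \<in> I \<and> dg i = p}))"
    by (simp flip: of_nat_eq_enat)
  also have "\<dots> \<le> (\<Sum>p\<in>dg ` I. vs_dim rat_field (cohomology p X))"
    by (intro sum_mono dim)
  also have "\<dots> \<le> hrk X"
    unfolding hrk_def using fin by (intro sum_le_suminf) auto
  finally show ?thesis .
qed


section \<open>Coordinate slices of the real moment-angle complex\<close>

text \<open>In a discrete space every singular simplex is constant, so all boundaries of 1-chains vanish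
  (the two faces cancel) and the points themselves are independent 0-cycles.\<close>

lemma independent_point_cycles:
  assumes "finite S"
  shows "\<exists>dg c. independent_cycles (discrete_topology S) S dg c"
proof -
  let ?D = "discrete_topology S"
  let ?pt = "\<lambda>p x. restrict (\<lambda>_. x) (standard_simplex p)"
  define c where "c x = frag_of (?pt 0 x)" for x :: 'a
  have const: "\<exists>x. s = ?pt p x" if s: "singular_simplex p ?D s" for p s
  proof -
    have "connectedin ?D (s ` standard_simplex p)"
    proof (rule connectedin_continuous_map_image)
      show "connectedin (subtopology (powertop_real UNIV) (standard_simplex p)) (standard_simplex p)"
        by (simp add: connectedin_subtopology connectedin_standard_simplex)
    qed (use s in \<open>auto simp: singular_simplex_def\<close>)
    then obtain x where "s ` standard_simplex p \<subseteq> {x}"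
      unfolding connectedin_discrete_topology by blast
    then show ?thesis
      using s by (intro exI[of _ x] ext) (auto simp: singular_simplex_def extensional_def)
  qed
  have bd1: "chain_boundary (Suc 0) b = 0" if "singular_chain (Suc 0) ?D b" for b
    using that unfolding singular_chain_def
  proof (induction b rule: frag_induction)
    case (one s)
    then obtain x where s: "s = ?pt (Suc 0) x"
      using const by blast
    have "singular_face (Suc 0) k s = ?pt 0 x" if "k \<le> Suc 0" for k
      using simplical_face_in_standard_simplex[of "Suc 0" k] that
      by (auto simp: singular_face_def s fun_eq_iff restrict_def)
    then show ?case
      by (simp add: chain_boundary_of)
  qed (auto simp: chain_boundary_diff)
  have pt_inj: "?pt 0 x = ?pt 0 y \<longleftrightarrow> x = y" for x y :: 'a
    using nonempty_standard_simplex[of 0] by (auto simp: fun_eq_iff restrict_def)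
  have "independent_cycles ?D S (\<lambda>_. 0) c"
    unfolding independent_cycles_def
  proof (intro conjI ballI allI impI)
    fix x assume "x \<in> S"
    then show "singular_relcycle 0 ?D {} (c x)"
      by (auto simp: singular_cycle c_def singular_chain_of singular_simplex_def chain_boundary_of)
  next
    fix p :: nat and n x
    assume bd: "singular_relboundary p ?D {} (\<Sum>x | x \<in> S \<and> 0 = p. frag_cmul (n x) (c x))"
      and x: "x \<in> S" "0 = p"
    have "(\<Sum>x\<in>S. frag_cmul (n x) (c x)) = 0"
      using bd bd1 x(2) by (auto simp: singular_boundary)
    then have "0 = Poly_Mapping.lookup (\<Sum>x\<in>S. frag_cmul (n x) (c x)) (?pt 0 x)"
      by simp
    also have "\<dots> = (\<Sum>y\<in>S. if y = x then n x else 0)"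
      unfolding lookup_sum by (rule sum.cong) (auto simp: c_def pt_inj lookup_frag_of)
    finally show "n x = 0"
      using assms x by simp
  qed (rule assms)
  then show ?thesis by blast
qed

text \<open>Intersecting the real moment-angle complex with the coordinate hyperplanes indexed by a simplex
  \<open>\<sigma>\<close> gives a copy of the real moment-angle complex of the link of \<open>\<sigma>\<close>. Working with these slices inside
  one ambient space avoids links and the accompanying homeomorphisms.\<close>

definition zero_slice :: "'v set \<Rightarrow> 'v set set \<Rightarrow> 'v set \<Rightarrow> ('v \<Rightarrow> real) set"
  where "zero_slice V K \<sigma> = {x \<in> V \<rightarrow>\<^sub>E {-1..1}.
    (\<exists>\<omega>\<in>K. \<forall>v\<in>V-\<omega>. x v \<in> {-1, 1}) \<and> (\<forall>v\<in>\<sigma>. x v = 0)}"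

abbreviation euclidean_power :: "'v set \<Rightarrow> ('v \<Rightarrow> real) topology"
  where "euclidean_power V \<equiv> product_topology (\<lambda>_. euclideanreal) V"

lemma real_moment_angle_eq: "real_moment_angle V K = subtopology (euclidean_power V) (zero_slice V K {})"
proof -
  have "(\<Pi>\<^sub>E i\<in>V. {-1..1}) \<inter> (\<Union>\<omega>\<in>K. simplex_power V (top_of_set {-1..1}) {-1, 1::real} \<omega>) = zero_slice V K {}"
    by (auto simp: zero_slice_def simplex_power_def)
  then show ?thesis
    by (simp add: real_moment_angle_def complex_power_def subtopology_subtopology
        flip: subtopology_product_topology)
qed

lemma continuous_map_coordinate_update:
  assumes "v \<in> V" "continuous_on UNIV h"
  shows "continuous_map (euclidean_power V) (euclidean_power V) (\<lambda>x. x(v := h (x v)))"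
proof -
  have h: "continuous_map euclideanreal euclideanreal h"
    using assms(2) by simp
  have "continuous_map (euclidean_power V) euclideanreal (\<lambda>x. (x(v := h (x v))) k)" if "k \<in> V" for k
  proof (cases "k = v")
    case True
    then show ?thesis
      using continuous_map_compose[OF continuous_map_product_projection[OF assms(1)] h]
      by (simp add: o_def)
  qed (use that continuous_map_product_projection in auto)
  moreover have "(\<lambda>x. x(v := h (x v))) \<in> topspace (euclidean_power V) \<rightarrow> extensional V"
    using assms(1) by (auto simp: extensional_def)
  ultimately show ?thesis
    by (simp add: continuous_map_componentwise image_subset_iff_funcset)
qed

text \<open>The slice is symmetric under the sign change of the coordinate \<open>v\<close>, and its wall \<open>x v = 0\<close> is the
  next slice. Folding is \<open>\<bar>x v\<bar>\<close>, and a collar of the wall is collapsed by \<open>max 0 (x v)\<close>: a point with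
  \<open>\<bar>x v\<bar> < 1\<close> lies in a cell on which \<open>v\<close> is a free coordinate, so \<open>x v\<close> can be changed at will.\<close>

lemma zero_slice_double:
  assumes v: "v \<in> V" "v \<notin> \<sigma>"
    and ind: "independent_cycles (subtopology (euclidean_power V) (zero_slice V K (insert v \<sigma>))) I dg (c :: 'i \<Rightarrow> _)"
  shows "\<exists>dg' c'. independent_cycles (subtopology (euclidean_power V) (zero_slice V K \<sigma>)) I dg' (c' :: 'i \<Rightarrow> _)"
proof -
  let ?E = "euclidean_power V" and ?M = "zero_slice V K \<sigma>"
  let ?Z = "subtopology ?E ?M"
  let ?P = "{x :: 'a \<Rightarrow> real. 0 \<le> x v}" and ?N = "{x :: 'a \<Rightarrow> real. x v \<le> 0}"
  let ?U = "{x :: 'a \<Rightarrow> real. x v < -1/2}"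
  have top: "topspace ?Z = ?M"
    by (auto simp: zero_slice_def PiE_def)
  \<comment> \<open>A coordinate equal to \<open>\<plusminus>1\<close> may be forced by the cell, so it has to stay \<open>\<plusminus>1\<close>; any other may be moved freely.\<close>
  have upd: "x(v := t) \<in> ?M" if x: "x \<in> ?M" and t: "t \<in> {-1..1}"
    and unit: "\<bar>x v\<bar> = 1 \<Longrightarrow> \<bar>t\<bar> = 1" for x t
  proof -
    obtain \<omega> where \<omega>: "\<omega> \<in> K" "\<forall>u\<in>V-\<omega>. x u \<in> {-1, 1}"
      using x by (auto simp: zero_slice_def)
    have "t \<in> {-1, 1}" if "v \<in> V - \<omega>"
    proof -
      have "x v \<in> {-1, 1}"
        using \<omega>(2) that by blast
      then have "\<bar>x v\<bar> = 1"
        by auto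
      from unit[OF this] show ?thesis
        by auto
    qed
    then have "\<forall>u\<in>V-\<omega>. (x(v := t)) u \<in> {-1, 1}"
      using \<omega>(2) by auto
    moreover have "x(v := t) \<in> V \<rightarrow>\<^sub>E {-1..1}"
      using x t v(1) by (auto simp: zero_slice_def PiE_iff extensional_def)
    moreover have "\<forall>u\<in>\<sigma>. (x(v := t)) u = 0"
      using x v(2) by (auto simp: zero_slice_def)
    ultimately show ?thesis
      unfolding zero_slice_def using \<omega>(1) by blast
  qed
  have bounds: "-1 \<le> x v" "x v \<le> 1" if "x \<in> ?M" for x
    using that v by (auto simp: zero_slice_def)
  have cont: "continuous_map (subtopology ?Z A) (subtopology ?Z B) (\<lambda>x. x(v := h (x v)))"
    if h: "continuous_on UNIV h" and "\<And>x. x \<in> ?M \<inter> A \<Longrightarrow> x(v := h (x v)) \<in> ?M \<inter> B" for h A B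
    using continuous_map_coordinate_update[OF v(1) h] that(2)
    by (auto simp: subtopology_subtopology continuous_map_in_subtopology
        intro!: continuous_map_from_subtopology)
  have proj: "continuous_map ?Z euclideanreal (\<lambda>x. x v)"
    by (intro continuous_map_from_subtopology continuous_map_product_projection v(1))
  have slice: "subtopology ?Z (?P \<inter> ?N) = subtopology ?E (zero_slice V K (insert v \<sigma>))"
    unfolding subtopology_subtopology by (rule arg_cong[where f = "subtopology ?E"]) (auto simp: zero_slice_def)
  show ?thesis
  proof (rule independent_cycles_double[where P = ?P and N = ?N and U = ?U])
    have "x(v := \<bar>x v\<bar>) \<in> ?M \<inter> ?P" if "x \<in> ?M \<inter> UNIV" for x
    proof -
      have "\<bar>x v\<bar> \<in> {-1..1}"
        using bounds[of x] that by (simp add: abs_le_iff)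
      then show ?thesis
        using upd[of x "\<bar>x v\<bar>"] that by simp
    qed
    from cont[where A = UNIV, OF continuous_on_rabs[OF continuous_on_id] this]
    show "continuous_map ?Z (subtopology ?Z ?P) (\<lambda>x. x(v := \<bar>x v\<bar>))"
      by simp
    have "x(v := - x v) \<in> ?M \<inter> ?N" if "x \<in> ?M \<inter> ?P" for x
      using upd[of x "- x v"] bounds[of x] that by auto
    from cont[OF continuous_on_minus[OF continuous_on_id] this]
    show "continuous_map (subtopology ?Z ?P) (subtopology ?Z ?N) (\<lambda>x. x(v := - x v))" .
    have "x(v := max 0 (x v)) \<in> ?M \<inter> ?P" if "x \<in> ?M \<inter> - ?U" for x
      using upd[of x "max 0 (x v)"] bounds[of x] that by auto
    from cont[OF continuous_on_max[OF continuous_on_const continuous_on_id] this]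
    show "continuous_map (subtopology ?Z (- ?U)) (subtopology ?Z ?P) (\<lambda>x. x(v := max 0 (x v)))" .
    show "?Z closure_of ?U \<subseteq> ?Z interior_of ?N"
    proof -
      have "closedin ?Z {x \<in> topspace ?Z. x v \<in> {..-1/2}}"
        by (rule closedin_continuous_map_preimage[OF proj]) auto
      then have "?Z closure_of (topspace ?Z \<inter> ?U) \<subseteq> {x \<in> topspace ?Z. x v \<in> {..-1/2}}"
        by (rule closure_of_minimal[rotated]) auto
      moreover have "openin ?Z {x \<in> topspace ?Z. x v \<in> {..<0}}"
        by (rule openin_continuous_map_preimage[OF proj]) auto
      then have "{x \<in> topspace ?Z. x v \<in> {..<0}} \<subseteq> ?Z interior_of ?N"
        by (rule interior_of_maximal[rotated]) auto
      ultimately show ?thesis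
        using closure_of_restrict[of ?Z ?U] by fastforce
    qed
    show "independent_cycles (subtopology ?Z (?P \<inter> ?N)) I dg c"
      unfolding slice by (rule ind)
  qed auto
qed

text \<open>A cell meeting the common zero set of the coordinates in \<open>\<omega>\<close> belongs to a simplex that contains
  \<open>\<omega>\<close>, hence to \<open>\<omega>\<close> itself by maximality; the remaining coordinates are then \<open>\<plusminus>1\<close>.\<close>

lemma zero_slice_maximal:
  assumes K: "abstract_simplicial_complex V K" and \<omega>: "\<omega> \<in> maximal_simplices K"
  shows "zero_slice V K \<omega> = (\<Pi>\<^sub>E v\<in>V. if v \<in> \<omega> then {0} else {-1, 1})"
proof
  have sub: "\<omega> \<subseteq> V" "\<omega> \<in> K"
    using K \<omega> by (auto simp: abstract_simplicial_complex_def maximal_simplices_def)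
  show "zero_slice V K \<omega> \<subseteq> (\<Pi>\<^sub>E v\<in>V. if v \<in> \<omega> then {0} else {-1, 1})"
  proof
    fix x assume x: "x \<in> zero_slice V K \<omega>"
    then obtain \<tau> where \<tau>: "\<tau> \<in> K" "\<forall>v\<in>V-\<tau>. x v \<in> {-1, 1}" and 0: "\<forall>v\<in>\<omega>. x v = 0"
      by (auto simp: zero_slice_def)
    then have "\<omega> \<subseteq> \<tau>"
      using sub(1) by force
    then have "\<tau> = \<omega>"
      using \<omega> \<tau>(1) by (auto simp: maximal_simplices_def)
    then show "x \<in> (\<Pi>\<^sub>E v\<in>V. if v \<in> \<omega> then {0} else {-1, 1})"
      using x \<tau>(2) 0 by (auto simp: zero_slice_def)
  qed
  show "(\<Pi>\<^sub>E v\<in>V. if v \<in> \<omega> then {0} else {-1, 1}) \<subseteq> zero_slice V K \<omega>"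
  proof
    fix x assume x: "x \<in> (\<Pi>\<^sub>E v\<in>V. if v \<in> \<omega> then {0} else {-1, 1::real})"
    have on: "x v = 0" if "v \<in> \<omega>" for v
      using PiE_mem[OF x, of v] that sub by auto
    have off: "x v \<in> {-1, 1}" if "v \<in> V - \<omega>" for v
      using PiE_mem[OF x, of v] that by auto
    have "x v \<in> {-1..1}" if "v \<in> V" for v
      using on[of v] off[of v] that by (cases "v \<in> \<omega>") auto
    then have "x \<in> V \<rightarrow>\<^sub>E {-1..1}"
      using x by (auto simp: PiE_def)
    then show "x \<in> zero_slice V K \<omega>"
      unfolding zero_slice_def using on off sub(2) by blast
  qed
qed

text \<open>Every maximal simplex gives a bound; the best one comes from a maximal simplex of least
  dimension. The hyperplanes are removed one at a time, starting from the \<open>2 ^ (card V - card \<omega>)\<close> points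
  in the intersection of all of them.\<close>

theorem hrk_real_moment_angle_ge:
  assumes K: "abstract_simplicial_complex V K" and V: "finite V" and \<omega>: "\<omega> \<in> maximal_simplices K"
  shows "2 ^ (card V - card \<omega>) \<le> hrk (real_moment_angle V K)"
proof -
  have sub: "\<omega> \<subseteq> V"
    using K \<omega> by (auto simp: abstract_simplicial_complex_def maximal_simplices_def)
  then have fin: "finite \<omega>"
    using V finite_subset by blast
  define S where "S = zero_slice V K \<omega>"
  have S: "S = (\<Pi>\<^sub>E v\<in>V. if v \<in> \<omega> then {0} else {-1, 1})"
    unfolding S_def by (rule zero_slice_maximal[OF K \<omega>])
  have finS: "finite S"
    unfolding S using V by (intro finite_PiE) auto
  have cardS: "card S = 2 ^ (card V - card \<omega>)"
  proof -
    have "card S = (\<Prod>v\<in>V. if v \<in> \<omega> then 1 else 2)"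
      unfolding S card_PiE[OF V] by (rule prod.cong) auto
    also have "\<dots> = 2 ^ card (V - \<omega>)"
      using V by (simp add: prod.If_cases Diff_eq)
    finally show ?thesis
      using sub fin by (simp add: card_Diff_subset)
  qed
  have "topspace (subtopology (euclidean_power V) S) = S"
    by (auto simp: S PiE_def)
  moreover have "t1_space (subtopology (euclidean_power V) S)"
    by (intro t1_space_subtopology Hausdorff_imp_t1_space) (simp add: Hausdorff_space_product_topology)
  ultimately have discrete: "subtopology (euclidean_power V) S = discrete_topology S"
    using finS by (intro finite_t1_space_imp_discrete_topology)
  have "\<exists>dg c. independent_cycles (subtopology (euclidean_power V) (zero_slice V K (\<omega> - \<tau>))) S dg c"
    if "finite \<tau>" "\<tau> \<subseteq> \<omega>" for \<tau>
    using that
  proof (induction \<tau> rule: finite_induct)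
    case empty
    show ?case
      using independent_point_cycles[OF finS] discrete by (simp flip: S_def)
  next
    case (insert v \<tau>)
    then obtain dg c where
      "independent_cycles (subtopology (euclidean_power V) (zero_slice V K (\<omega> - \<tau>))) S dg c"
      by blast
    moreover have "\<omega> - \<tau> = insert v (\<omega> - insert v \<tau>)"
      using insert by auto
    ultimately have "independent_cycles (subtopology (euclidean_power V)
        (zero_slice V K (insert v (\<omega> - insert v \<tau>)))) S dg c"
      by simp
    then show ?case
      using zero_slice_double[of v V "\<omega> - insert v \<tau>" K S dg c] insert.prems sub by blast
  qed
  from this[OF fin] obtain dg c where "independent_cycles (real_moment_angle V K) S dg c"
    by (auto simp: real_moment_angle_eq)
  then have "enat (card S) \<le> hrk (real_moment_angle V K)"
    by (rule card_le_hrk)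
  moreover have "enat (2 ^ k) = 2 ^ k" for k
    by (induction k) (auto simp: one_enat_def numeral_eq_enat simp flip: times_enat_simps)
  ultimately show ?thesis
    by (simp add: cardS)
qed

theorem theorem3p2:
  fixes K :: "nat set set" and m n :: nat
  assumes "abstract_simplicial_complex {1..m} K"
    and "mdim K = int n - 1"
  shows "hrk (real_moment_angle {1..m} K) \<ge> 2 ^ (m - n)"
proof -
  have fin: "finite K" and "{} \<in> K"
    using assms(1) finite_subset[of K "Pow {1..m}"] by (auto simp: abstract_simplicial_complex_def)
  then obtain \<omega>\<^sub>0 where "\<omega>\<^sub>0 \<in> K" "\<forall>\<tau>\<in>K. \<omega>\<^sub>0 \<subseteq> \<tau> \<longrightarrow> \<omega>\<^sub>0 = \<tau>"
    using finite_has_maximal2[of K "{}"] by metis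
  then have "maximal_simplices K \<noteq> {}"
    by (auto simp: maximal_simplices_def)
  moreover have "finite (maximal_simplices K)"
    using fin by (simp add: maximal_simplices_def)
  ultimately have "mdim K \<in> simplex_dim ` maximal_simplices K"
    unfolding mdim_def by (intro Min_in) auto
  then obtain \<omega> where \<omega>: "\<omega> \<in> maximal_simplices K" "card \<omega> = n"
    using assms(2) by (auto simp: simplex_dim_def)
  then show ?thesis
    using hrk_real_moment_angle_ge[OF assms(1) _ \<omega>(1)] by simp
qed

end
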